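(* Let $n\ge 1$ and let $D\subset\mathbb{RP}^n$ be a properly convex open set. Then its elliptic tube $D^e\subset\mathbb{CP}^n$ is $\mathbb{C}$-convex.
   Context: A set $E\subset\mathbb{RP}^n$ is convex if it contains no projective line and its intersection with every projective line is connected. A convex set $E\subset\mathbb{RP}^n$ is properly convex if it is not contained in a projective hyperplane and contains no affine line (a projective line minus a point). Elliptic tubes: regard $\mathbb{RP}^n\subset\mathbb{CP}^n$ and write $\pi$ for the projections $\mathbb{R}^{n+1}\setminus\{0\}\to\mathbb{RP}^n$, $\mathbb{C}^{n+1}\setminus\{0\}\to\mathbb{CP}^n$. A closed segment $I\subset\mathbb{RP}^n$ with endpoints $a_0,a_1$ can be written as $I=\pi(\{c_0v_0+c_1v_1\neq 0 : c_0,c_1\in\mathbb{R},\ c_0c_1\ge 0\})$ for suitable $v_0,v_1\in\mathbb{R}^{n+1}$ with $\pi(v_i)=a_i$; put $I^e=\pi(\{c_0v_0+c_1v_1\neq 0 : c_0,c_1\in\mathbb{C},\ \mathrm{Re}(c_0\overline{c_1})\ge 0\})$ (the closed disk with diameter $I$ in the complexification of the real projective line containing $I$). For $D\subset\mathbb{RP}^n$, the elliptic tube is $D^e=\bigcup\{I^e : I\subset D \text{ a closed segment}\}\subset\mathbb{CP}^n$. A set $E\subset\mathbb{CP}^n$ is $\mathbb{C}$-convex if it contains no complex projective line and its intersection with every complex projective line is connected and simply connected (the empty intersection being allowed). *)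

theory Defs
  imports "HOL-Analysis.Analysis"
begin

text \<open>
  The projective space of the coordinate space \<open>'a ^ 'n\<close>: its projective dimension is
  \<open>CARD('n) - 1\<close>. The map \<open>proj_pt\<close> is the projection \<open>\<pi>\<close>; it is meaningful only on nonzero
  vectors, \<open>proj_pt 0\<close> being unspecified.
\<close>

quotient_type (overloaded) ('a, 'n) proj_space = "'a::field ^ 'n::finite" /
  partial: "\<lambda>v w. v \<noteq> 0 \<and> w \<noteq> 0 \<and> (\<exists>c. c \<noteq> 0 \<and> w = c *s v)"
  morphisms proj_rep proj_pt
proof (rule part_equivpI)
  show "\<exists>v::'a ^ 'n. v \<noteq> 0 \<and> v \<noteq> 0 \<and> (\<exists>c. c \<noteq> 0 \<and> v = c *s v)"
    by (intro exI[of _ "1::'a ^ 'n"] conjI exI[of _ "1::'a"]) (simp_all add: vec_eq_iff)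
  show "symp (\<lambda>v w::'a ^ 'n. v \<noteq> 0 \<and> w \<noteq> 0 \<and> (\<exists>c. c \<noteq> 0 \<and> w = c *s v))"
  proof (rule sympI, elim conjE exE, intro conjI)
    fix v w :: "'a ^ 'n" and c :: 'a
    assume "c \<noteq> 0" "w = c *s v"
    then show "\<exists>d. d \<noteq> 0 \<and> v = d *s w"
      by (intro exI[of _ "inverse c"]) simp
  qed
  show "transp (\<lambda>v w::'a ^ 'n. v \<noteq> 0 \<and> w \<noteq> 0 \<and> (\<exists>c. c \<noteq> 0 \<and> w = c *s v))"
  proof (rule transpI, elim conjE exE, intro conjI)
    fix u v w :: "'a ^ 'n" and c d :: 'a
    assume "c \<noteq> 0" "d \<noteq> 0" "v = c *s u" "w = d *s v"
    then show "\<exists>e. e \<noteq> 0 \<and> w = e *s u"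
      by (intro exI[of _ "d * c"]) simp
  qed
qed

lemma proj_pt_eq_iff:
  fixes v w :: "'a::field ^ 'n::finite"
  assumes "v \<noteq> 0" and "w \<noteq> 0"
  shows "proj_pt v = proj_pt w \<longleftrightarrow> (\<exists>c. c \<noteq> 0 \<and> w = c *s v)"
proof -
  have refl: "\<exists>c. c \<noteq> 0 \<and> u = c *s u" for u :: "'a ^ 'n"
    by (intro exI[of _ 1]) simp
  show ?thesis
    using Quotient3_rel[OF Quotient3_proj_space, of v w] assms refl[of v] refl[of w] by blast
qed

lemma proj_pt_surj:
  fixes p :: "('a::field, 'n::finite) proj_space"
  obtains v where "v \<noteq> 0" and "p = proj_pt v"
proof
  show "proj_rep p \<noteq> 0"
    using Quotient3_rep_reflp[OF Quotient3_proj_space, of p] by (rule conjunct1)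
  show "p = proj_pt (proj_rep p)"
    by (rule Quotient3_abs_rep[OF Quotient3_proj_space, symmetric])
qed

text \<open>The quotient topology with respect to the projection from the nonzero vectors.\<close>

instantiation proj_space :: (real_normed_field, finite) topological_space
begin

definition open_proj_space :: "('a, 'n::finite) proj_space set \<Rightarrow> bool" where
  "open_proj_space U \<longleftrightarrow> openin (top_of_set (- {0})) {v. v \<noteq> 0 \<and> proj_pt v \<in> U}"

instance
proof
  have "{v :: 'a ^ 'b. v \<noteq> 0 \<and> proj_pt v \<in> UNIV} = - {0}"
    by auto
  then show "open (UNIV :: ('a, 'b) proj_space set)"
    unfolding open_proj_space_def by (simp only: openin_subtopology_self)
next
  fix S T :: "('a, 'b) proj_space set"
  assume "open S" "open T"
  moreover have "{v. v \<noteq> 0 \<and> proj_pt v \<in> S \<inter> T}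
      = {v. v \<noteq> 0 \<and> proj_pt v \<in> S} \<inter> {v. v \<noteq> 0 \<and> proj_pt v \<in> T}"
    by auto
  ultimately show "open (S \<inter> T)"
    unfolding open_proj_space_def by (simp only: openin_Int)
next
  fix K :: "('a, 'b) proj_space set set"
  assume "\<forall>S\<in>K. open S"
  then have "openin (top_of_set (- {0})) (\<Union>((\<lambda>S. {v. v \<noteq> 0 \<and> proj_pt v \<in> S}) ` K))"
    unfolding open_proj_space_def by (intro openin_Union) blast
  moreover have "{v. v \<noteq> 0 \<and> proj_pt v \<in> \<Union>K} = \<Union>((\<lambda>S. {v. v \<noteq> 0 \<and> proj_pt v \<in> S}) ` K)"
    by auto
  ultimately show "open (\<Union>K)"
    unfolding open_proj_space_def by (simp only:)
qed

end

definition proj_line :: "('a::field, 'n::finite) proj_space set \<Rightarrow> bool" where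
  "proj_line L \<longleftrightarrow> (\<exists>W. vec.subspace W \<and> vec.dim W = 2 \<and> L = proj_pt ` (W - {0}))"

definition proj_hyperplane :: "('a::field, 'n::finite) proj_space set \<Rightarrow> bool" where
  "proj_hyperplane H \<longleftrightarrow>
     (\<exists>W. vec.subspace W \<and> vec.dim W + 1 = CARD('n) \<and> H = proj_pt ` (W - {0}))"

definition affine_line :: "('a::field, 'n::finite) proj_space set \<Rightarrow> bool" where
  "affine_line A \<longleftrightarrow> (\<exists>L p. proj_line L \<and> p \<in> L \<and> A = L - {p})"

definition proj_convex :: "(real, 'n::finite) proj_space set \<Rightarrow> bool" where
  "proj_convex E \<longleftrightarrow>
     (\<forall>L. proj_line L \<longrightarrow> \<not> L \<subseteq> E) \<and> (\<forall>L. proj_line L \<longrightarrow> connected (E \<inter> L))"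

definition properly_convex :: "(real, 'n::finite) proj_space set \<Rightarrow> bool" where
  "properly_convex E \<longleftrightarrow> proj_convex E \<and>
     (\<forall>H. proj_hyperplane H \<longrightarrow> \<not> E \<subseteq> H) \<and> (\<forall>A. affine_line A \<longrightarrow> \<not> A \<subseteq> E)"

definition proj_segment :: "real ^ 'n \<Rightarrow> real ^ 'n \<Rightarrow> (real, 'n::finite) proj_space set" where
  "proj_segment v0 v1 =
     {proj_pt (c0 *s v0 + c1 *s v1) | c0 c1. c0 *s v0 + c1 *s v1 \<noteq> 0 \<and> c0 * c1 \<ge> 0}"

definition complexify :: "real ^ 'n \<Rightarrow> complex ^ 'n" where
  "complexify v = (\<chi> i. complex_of_real (v $ i))"

definition segment_disk :: "real ^ 'n \<Rightarrow> real ^ 'n \<Rightarrow> (complex, 'n::finite) proj_space set" where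
  "segment_disk v0 v1 =
     {proj_pt (c0 *s complexify v0 + c1 *s complexify v1) | c0 c1.
        c0 *s complexify v0 + c1 *s complexify v1 \<noteq> 0 \<and> Re (c0 * cnj c1) \<ge> 0}"

text \<open>
  The union runs over the closed segments \<open>I \<subseteq> D\<close> with distinct endpoints, each given by
  representatives \<open>v0\<close>, \<open>v1\<close> of its endpoints. The two segments with the same endpoints
  correspond to the two choices of relative sign of \<open>v0\<close> and \<open>v1\<close>; other rescalings of \<open>v0\<close>
  and \<open>v1\<close> change neither the segment nor its disk.
\<close>

definition elliptic_tube :: "(real, 'n::finite) proj_space set \<Rightarrow> (complex, 'n) proj_space set" where
  "elliptic_tube D =
     \<Union> {segment_disk v0 v1 | v0 v1.
           v0 \<noteq> 0 \<and> v1 \<noteq> 0 \<and> proj_pt v0 \<noteq> proj_pt v1 \<and> proj_segment v0 v1 \<subseteq> D}"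

text \<open>
  The constant \<open>simply_connected\<close> of the library entails path-connectedness and holds of the
  empty set.
\<close>

definition complex_convex :: "(complex, 'n::finite) proj_space set \<Rightarrow> bool" where
  "complex_convex E \<longleftrightarrow>
     (\<forall>L. proj_line L \<longrightarrow> \<not> L \<subseteq> E) \<and>
     (\<forall>L. proj_line L \<longrightarrow> connected (E \<inter> L) \<and> simply_connected (E \<inter> L))"

end

theory Submission
  imports Defs
begin

text \<open>
  The cone over \<open>D\<close> is \<open>C \<union> - C\<close> for an open convex cone \<open>C\<close>. The coefficients \<open>c0\<close>, \<open>c1\<close> of a point
  of the elliptic tube enclose an angle of at most \<open>\<pi> / 2\<close>, so a common rotation moves both into
  the closed first quadrant; hence the tube is the projection of the convex tube domain
  \<open>T = C + \<i> C\<close>. Its intersection with the line of a plane \<open>W\<close> is the projection of the convex set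
  \<open>T \<inter> W\<close>. The fibres of this projection are convex cones of scalars, so a partition of unity
  yields a continuous section, and the intersection inherits simple connectedness from \<open>T \<inter> W\<close>.
  A real functional that is positive on \<open>C\<close> has no zero on \<open>T\<close>, but it has one in every plane \<open>W\<close>.
\<close>

subsection \<open>Continuous selections\<close>

text \<open>Near each point one constant is an admissible value. Gluing these constants with a
  partition of unity gives convex combinations of elements of \<open>\<Phi> x\<close>, so convexity
  keeps the value at \<open>x\<close> in \<open>\<Phi> x\<close>.\<close>

lemma continuous_selection:
  fixes \<Phi> :: "'a::{metric_space,second_countable_topology} \<Rightarrow> 'b::real_inner set"
  assumes convex: "\<And>x. x \<in> S \<Longrightarrow> convex (\<Phi> x)"
    and locally_constant: "\<And>x. x \<in> S \<Longrightarrow> \<exists>U c. open U \<and> x \<in> U \<and> (\<forall>y\<in>S \<inter> U. c \<in> \<Phi> y)"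
  obtains f where "continuous_on S f" "\<And>x. x \<in> S \<Longrightarrow> f x \<in> \<Phi> x"
proof -
  define \<B> where "\<B> = {U. open U \<and> (\<exists>c. \<forall>y\<in>S \<inter> U. c \<in> \<Phi> y)}"
  have "S \<subseteq> \<Union>\<B>"
    using locally_constant unfolding \<B>_def by blast
  then obtain \<C> where cover: "S \<subseteq> \<Union>\<C>"
    and refine: "\<And>U. U \<in> \<C> \<Longrightarrow> open U \<and> (\<exists>T. T \<in> \<B> \<and> U \<subseteq> T)"
    and fin: "\<And>x. x \<in> S \<Longrightarrow> \<exists>V. open V \<and> x \<in> V \<and> finite {U. U \<in> \<C> \<and> U \<inter> V \<noteq> {}}"
    by (rule paracompact) (auto simp: \<B>_def)
  have "\<exists>c. \<forall>y\<in>S \<inter> U. c \<in> \<Phi> y" if "U \<in> \<C>" for U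
    using refine[OF that] unfolding \<B>_def by blast
  then obtain c where c: "\<And>U y. U \<in> \<C> \<Longrightarrow> y \<in> S \<Longrightarrow> y \<in> U \<Longrightarrow> c U \<in> \<Phi> y"
    by (metis IntI)
  obtain H :: "['a set, 'a] \<Rightarrow> real"
    where contH: "\<And>U. U \<in> \<C> \<Longrightarrow> continuous_on S (H U)"
      and H_ge0: "\<And>U x. \<lbrakk>U \<in> \<C>; x \<in> S\<rbrakk> \<Longrightarrow> 0 \<le> H U x"
      and H_eq0: "\<And>x U. \<lbrakk>U \<in> \<C>; x \<in> S; x \<notin> U\<rbrakk> \<Longrightarrow> H U x = 0"
      and H_sum: "\<And>x. x \<in> S \<Longrightarrow> supp_sum (\<lambda>W. H W x) \<C> = 1"
      and H_fin: "\<And>x. x \<in> S \<Longrightarrow> \<exists>V. open V \<and> x \<in> V \<and> finite {U \<in> \<C>. \<exists>x\<in>V. H U x \<noteq> 0}"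
    by (rule subordinate_partition_of_unity[OF cover _ fin]) (use refine in auto)
  define f where "f x = supp_sum (\<lambda>U. H U x *\<^sub>R c U) \<C>" for x
  show thesis
  proof
    show "continuous_on S f"
      unfolding continuous_on_eq_continuous_within
    proof
      fix a assume "a \<in> S"
      obtain N where N: "open N" "a \<in> N" and finN: "finite {U \<in> \<C>. \<exists>a\<in>N. H U a \<noteq> 0}"
        using H_fin \<open>a \<in> S\<close> by auto
      show "continuous (at a within S) f"
      proof (rule continuous_transform_within_openin)
        \<comment> \<open>Local finiteness: on \<open>N\<close> only finitely many weights are not
          identically zero, so near \<open>a\<close> the function agrees with a finite sum of
          continuous terms.\<close>
        show "continuous (at a within S) (\<lambda>x. \<Sum>U\<in>{U \<in> \<C>. \<exists>x\<in>N. H U x \<noteq> 0}. H U x *\<^sub>R c U)"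
          using contH \<open>a \<in> S\<close>
          by (intro continuous_intros) (auto simp: continuous_on_eq_continuous_within)
        show "openin (top_of_set S) (S \<inter> N)"
          using N by blast
        show "a \<in> S \<inter> N"
          using \<open>a \<in> S\<close> N by blast
        show "(\<Sum>U\<in>{U \<in> \<C>. \<exists>x\<in>N. H U x \<noteq> 0}. H U x *\<^sub>R c U) = f x" if "x \<in> S \<inter> N" for x
          using that by (auto simp: f_def supp_sum_def support_on_def
              intro!: sum.mono_neutral_right[OF finN])
      qed
    qed
    show "f x \<in> \<Phi> x" if "x \<in> S" for x
      unfolding f_def
    proof (rule convex_supp_sum)
      show "0 \<le> H U x \<and> (H U x = 0 \<or> c U \<in> \<Phi> x)" if "U \<in> \<C>" for U
        using that c H_eq0 H_ge0 \<open>x \<in> S\<close> by blast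
    qed (use that convex H_sum in simp_all)
  qed
qed

subsection \<open>The topology of projective space\<close>

lemma proj_pt_scale:
  fixes v :: "'a::field ^ 'n::finite"
  assumes "c \<noteq> 0" "v \<noteq> 0"
  shows "proj_pt (c *s v) = proj_pt v"
  using assms proj_pt_eq_iff[of v "c *s v"] by auto

lemma open_proj_space_iff:
  fixes U :: "('a::real_normed_field, 'n::finite) proj_space set"
  shows "open U \<longleftrightarrow> open {v. v \<noteq> 0 \<and> proj_pt v \<in> U}"
proof -
  have "open (- {0 :: 'a ^ 'n})"
    by auto
  then show ?thesis
    unfolding open_proj_space_def by (auto simp: openin_open_eq)
qed

lemma continuous_on_proj_pt:
  "continuous_on (- {0 :: 'a::real_normed_field ^ 'n::finite}) proj_pt"
proof -
  have "open (proj_pt -` B \<inter> - {0 :: 'a ^ 'n})" if "open B" for B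
  proof -
    have "proj_pt -` B \<inter> - {0 :: 'a ^ 'n} = {v. v \<noteq> 0 \<and> proj_pt v \<in> B}"
      by auto
    then show ?thesis
      using that by (simp add: open_proj_space_iff)
  qed
  moreover have "open (- {0 :: 'a ^ 'n})"
    by auto
  ultimately show ?thesis
    by (simp add: continuous_on_open_vimage)
qed

text \<open>The universal property of the quotient, localized: since \<open>U\<close> is open, the
  projection from its full preimage onto \<open>U\<close> is again a quotient map.\<close>

lemma continuous_on_proj_space:
  fixes f :: "('a::real_normed_field, 'n::finite) proj_space \<Rightarrow> 'b::topological_space"
  assumes "open U" and cont: "continuous_on {v. v \<noteq> 0 \<and> proj_pt v \<in> U} (\<lambda>v. f (proj_pt v))"
  shows "continuous_on U f"
proof -
  have "open (f -` B \<inter> U)" if "open B" for B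
  proof -
    have "open ((\<lambda>v. f (proj_pt v)) -` B \<inter> {v. v \<noteq> 0 \<and> proj_pt v \<in> U})"
      using cont that \<open>open U\<close> by (simp add: continuous_on_open_vimage open_proj_space_iff)
    moreover have "(\<lambda>v. f (proj_pt v)) -` B \<inter> {v. v \<noteq> 0 \<and> proj_pt v \<in> U}
        = {v. v \<noteq> 0 \<and> proj_pt v \<in> f -` B \<inter> U}"
      by auto
    ultimately show ?thesis
      by (simp only: open_proj_space_iff)
  qed
  then show ?thesis
    using \<open>open U\<close> by (simp add: continuous_on_open_vimage)
qed

text \<open>Invariance under scaling makes the set of vectors satisfying \<open>Q\<close> a union of
  fibres, hence the full preimage of its image.\<close>

lemma open_proj_space_Collect:
  fixes Q :: "'a::real_normed_field ^ 'n::finite \<Rightarrow> bool"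
  assumes "open {v. v \<noteq> 0 \<and> Q v}" and Q: "\<And>c v. c \<noteq> 0 \<Longrightarrow> Q (c *s v) \<longleftrightarrow> Q v"
  shows "open {proj_pt v |v. v \<noteq> 0 \<and> Q v}"
    and "v \<noteq> 0 \<Longrightarrow> proj_pt v \<in> {proj_pt v |v. v \<noteq> 0 \<and> Q v} \<longleftrightarrow> Q v"
proof -
  show *: "proj_pt v \<in> {proj_pt v |v. v \<noteq> 0 \<and> Q v} \<longleftrightarrow> Q v" if "v \<noteq> 0" for v
  proof
    assume "proj_pt v \<in> {proj_pt v |v. v \<noteq> 0 \<and> Q v}"
    then obtain w where "w \<noteq> 0" "Q w" "proj_pt v = proj_pt w"
      by blast
    then show "Q v"
      using Q that proj_pt_eq_iff by blast
  qed (use that in blast)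
  have "{v. v \<noteq> 0 \<and> proj_pt v \<in> {proj_pt v |v. v \<noteq> 0 \<and> Q v}} = {v. v \<noteq> 0 \<and> Q v}"
    using * by blast
  then show "open {proj_pt v |v. v \<noteq> 0 \<and> Q v}"
    using assms(1) unfolding open_proj_space_iff by (simp only:)
qed

lemma proj_line_span:
  fixes u x :: "'a::field ^ 'n::finite"
  assumes "u \<noteq> 0" "\<And>c. x \<noteq> c *s u"
  shows "proj_line (proj_pt ` ({a *s u + b *s x |a b. True} - {0}))"
proof -
  have "x \<notin> vec.span {u}"
    using assms(2) by (auto simp: vec.span_singleton)
  then have "x \<noteq> u" and ind: "vec.independent {x, u}"
    using assms(1) vec.independent_insert[of x "{u}"] vec.span_base[of u "{u}"] by auto
  then have "vec.dim (vec.span {x, u}) = 2"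
    using vec.dim_eq_card_independent[OF ind] by (simp add: vec.dim_span)
  moreover have "vec.span {x, u} = {a *s u + b *s x |a b. True}"
  proof (intro set_eqI iffI)
    fix y assume "y \<in> vec.span {x, u}"
    then obtain b a where "y - b *s x = a *s u"
      by (auto simp: vec.span_insert vec.span_singleton)
    then have "y = a *s u + b *s x"
      by (simp add: algebra_simps)
    then show "y \<in> {a *s u + b *s x |a b. True}"
      by blast
  next
    fix y assume "y \<in> {a *s u + b *s x |a b. True}"
    then show "y \<in> vec.span {x, u}"
      by (auto intro: vec.span_add vec.span_scale vec.span_base)
  qed
  ultimately show ?thesis
    unfolding proj_line_def by (metis vec.subspace_span)
qed

subsection \<open>The cone over an open convex set\<close>

text \<open>The segment is compact, so it has a uniform margin \<open>e\<close> inside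
  \<open>P\<close>. Moving the endpoint by less than \<open>e\<close> moves every point of the
  segment by at most that much.\<close>

lemma open_segment_subset_open:
  fixes u :: "'a::real_normed_vector"
  assumes "open P"
  shows "open {x. closed_segment u x \<subseteq> P}"
  unfolding open_contains_ball
proof
  fix x assume "x \<in> {x. closed_segment u x \<subseteq> P}"
  then obtain e where e: "e > 0" "(\<Union>y\<in>closed_segment u x. cball y e) \<subseteq> P"
    using compact_subset_open_imp_cball_epsilon_subset[OF compact_segment assms, of u x] by auto
  have "closed_segment u y \<subseteq> P" if "dist x y < e" for y
  proof
    fix z assume "z \<in> closed_segment u y"
    then obtain t where t: "0 \<le> t" "t \<le> 1" "z = (1 - t) *\<^sub>R u + t *\<^sub>R y"
      by (auto simp: in_segment)
    have "dist ((1 - t) *\<^sub>R u + t *\<^sub>R x) z = t * dist x y"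
      using t by (simp add: dist_norm flip: scaleR_diff_right)
    also have "\<dots> \<le> e"
      using that t mult_left_le_one_le[of "dist x y" t] by simp
    finally show "z \<in> P"
      using e t by (force simp: in_segment)
  qed
  then show "\<exists>e>0. ball x e \<subseteq> {x. closed_segment u x \<subseteq> P}"
    using e(1) by (auto simp: subset_eq)
qed

text \<open>In the application \<open>P\<close> consists of the nonzero vectors over
  \<open>D\<close>, and the segments from \<open>u\<close> to \<open>x\<close> and to
  \<open>- x\<close> represent the two projective segments between two points. Exactly one of them
  lies in \<open>P\<close>, and by openness the choice cannot jump along a connected subset of
  \<open>P\<close>.\<close>

lemma convex_cone_of_symmetric_set:
  fixes P :: "'a::real_normed_vector set"
  assumes "open P" "0 \<notin> P"
    and scale: "\<And>r x. r \<noteq> 0 \<Longrightarrow> x \<in> P \<Longrightarrow> r *\<^sub>R x \<in> P"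
    and ex: "\<And>u x. u \<in> P \<Longrightarrow> x \<in> P \<Longrightarrow> closed_segment u x \<subseteq> P \<or> closed_segment u (- x) \<subseteq> P"
    and not_both: "\<And>u x. closed_segment u x \<subseteq> P \<Longrightarrow> closed_segment u (- x) \<subseteq> P \<Longrightarrow> False"
  obtains C where "open C" "convex C" "0 \<notin> C" "\<And>r x. r > 0 \<Longrightarrow> x \<in> C \<Longrightarrow> r *\<^sub>R x \<in> C"
    "\<And>x. x \<in> P \<longleftrightarrow> x \<in> C \<or> - x \<in> C"
proof (cases "P = {}")
  case True
  then show ?thesis
    using that[of "{}"] by simp
next
  case False
  then obtain v where "v \<in> P"
    by blast
  \<comment> \<open>\<open>C\<close> turns out to be the connected component of \<open>v\<close> in \<open>P\<close>.\<close>
  define C where "C = {x. closed_segment v x \<subseteq> P}"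
  have "C \<subseteq> P"
    unfolding C_def by auto
  \<comment> \<open>For fixed \<open>u\<close>, the admissible ends for \<open>z\<close> and for
    \<open>- z\<close> form two open sets that cover \<open>K\<close> and do not meet; a connected
    \<open>K\<close> touching the first lies inside it.\<close>
  have propagate: "closed_segment u y \<subseteq> P"
    if "connected K" "K \<subseteq> P" "x \<in> K" "y \<in> K" "closed_segment u x \<subseteq> P" for u x y K
  proof -
    let ?A = "{z. closed_segment u z \<subseteq> P}"
    let ?B = "{z. closed_segment u (- z) \<subseteq> P}"
    have "open ?A"
      by (rule open_segment_subset_open[OF \<open>open P\<close>])
    moreover have "?B = uminus ` ?A"
      by force
    then have "open ?B"
      using \<open>open ?A\<close> open_negations by metis
    moreover have "u \<in> P"
      using that(5) by auto
    then have "K \<subseteq> ?A \<union> ?B"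
      using ex that(2) by blast
    moreover have "?A \<inter> ?B \<inter> K = {}"
      using not_both by blast
    moreover have "?A \<inter> K \<noteq> {}"
      using that by blast
    ultimately have "?B \<inter> K = {}"
      using connectedD[OF \<open>connected K\<close>] by blast
    then show ?thesis
      using \<open>K \<subseteq> ?A \<union> ?B\<close> \<open>y \<in> K\<close> by blast
  qed
  have "closed_segment x y \<subseteq> C" if "x \<in> C" "y \<in> C" for x y
  proof -
    have x: "closed_segment v x \<subseteq> P" "closed_segment x v \<subseteq> P" and y: "closed_segment v y \<subseteq> P"
      using that by (auto simp: C_def closed_segment_commute)
    \<comment> \<open>\<open>propagate\<close> is used twice: first \<open>x\<close> is fixed and
      the other end runs from \<open>v\<close> to \<open>y\<close>, then \<open>v\<close> is fixed
      and the other end runs from \<open>x\<close> to \<open>z\<close>.\<close>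
    have xy: "closed_segment x y \<subseteq> P"
      using propagate[OF connected_segment(1) y _ _ x(2)] by simp
    have "closed_segment v z \<subseteq> P" if "z \<in> closed_segment x y" for z
      using propagate[OF connected_segment(1) xy _ that x(1)] by simp
    then show ?thesis
      unfolding C_def by blast
  qed
  then have "convex C"
    by (simp add: convex_contains_segment)
  moreover have "r *\<^sub>R x \<in> C" if "r > 0" "x \<in> C" for r x
  proof -
    have "closed_segment x (r *\<^sub>R x) \<subseteq> P"
    proof
      fix z assume "z \<in> closed_segment x (r *\<^sub>R x)"
      then obtain t where t: "0 \<le> t" "t \<le> 1" "z = (1 - t) *\<^sub>R x + t *\<^sub>R (r *\<^sub>R x)"
        by (auto simp: in_segment)
      then have z: "z = ((1 - t) * 1 + t * r) *\<^sub>R x"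
        by (simp add: algebra_simps)
      have "(1 - t) * 1 + t * r > 0"
        using t \<open>r > 0\<close> by (cases "t = 0") (auto intro: add_nonneg_pos)
      then show "z \<in> P"
        unfolding z using \<open>x \<in> C\<close> \<open>C \<subseteq> P\<close> by (intro scale) auto
    qed
    then show ?thesis
      using propagate[OF connected_segment(1), of x "r *\<^sub>R x" x "r *\<^sub>R x" v] \<open>x \<in> C\<close>
      by (simp add: C_def)
  qed
  moreover have "x \<in> P \<longleftrightarrow> x \<in> C \<or> - x \<in> C" for x
    using ex[OF \<open>v \<in> P\<close>, of x] scale[of "-1" "- x"] \<open>C \<subseteq> P\<close> by (auto simp: C_def)
  moreover have "open C"
    unfolding C_def by (rule open_segment_subset_open[OF \<open>open P\<close>])
  ultimately show ?thesis
    using that \<open>C \<subseteq> P\<close> \<open>0 \<notin> P\<close> by blast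
qed

text \<open>Strict Cauchy-Schwarz: the determinant is \<open>u \<bullet> u\<close> times the squared
  length of the part \<open>?d\<close> of \<open>x\<close> orthogonal to \<open>u\<close>.\<close>

lemma Gram_determinant_pos:
  fixes u x :: "'a::real_inner"
  assumes "u \<noteq> 0" "\<And>c. x \<noteq> c *\<^sub>R u"
  shows "(u \<bullet> u) * (x \<bullet> x) - (u \<bullet> x)\<^sup>2 > 0"
proof -
  let ?d = "x - ((u \<bullet> x) / (u \<bullet> u)) *\<^sub>R u"
  have "u \<bullet> u > 0"
    using assms(1) by simp
  moreover have "?d \<bullet> ?d > 0"
    using assms(2) by simp
  ultimately have "0 < (u \<bullet> u) * (?d \<bullet> ?d)"
    by simp
  also have "?d \<bullet> ?d = x \<bullet> x - (u \<bullet> x)\<^sup>2 / (u \<bullet> u)"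
    using \<open>u \<bullet> u > 0\<close>
    by (simp add: inner_diff_left inner_diff_right inner_commute power2_eq_square field_simps)
  also have "(u \<bullet> u) * (x \<bullet> x - (u \<bullet> x)\<^sup>2 / (u \<bullet> u)) = (u \<bullet> u) * (x \<bullet> x) - (u \<bullet> x)\<^sup>2"
    using \<open>u \<bullet> u > 0\<close> by (simp add: field_simps)
  finally show ?thesis .
qed

text \<open>The two clauses of \<open>proj_convex\<close> supply the two segment hypotheses of
  \<open>convex_cone_of_symmetric_set\<close>: both segments in \<open>P\<close> would put a whole
  projective line into \<open>D\<close>, while neither in \<open>P\<close> would disconnect the
  intersection of \<open>D\<close> with that line.\<close>

lemma convex_cone_of_proj_convex:
  fixes D :: "(real, 'n::finite) proj_space set"
  assumes "proj_convex D" "open D"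
  obtains C where "open C" "convex C" "0 \<notin> C" "\<And>r x. r > 0 \<Longrightarrow> x \<in> C \<Longrightarrow> r *\<^sub>R x \<in> C"
    "\<And>v. v \<noteq> 0 \<Longrightarrow> proj_pt v \<in> D \<longleftrightarrow> v \<in> C \<or> - v \<in> C"
proof -
  define P where "P = {v. v \<noteq> 0 \<and> proj_pt v \<in> D}"
  have "open P"
    using \<open>open D\<close> by (simp add: P_def open_proj_space_iff)
  have "0 \<notin> P"
    by (simp add: P_def)
  have scale: "r *\<^sub>R x \<in> P" if "r \<noteq> 0" "x \<in> P" for r x
    using that proj_pt_scale[of r x] by (simp add: P_def scalar_mult_eq_scaleR)
  have scale_iff: "r *\<^sub>R x \<in> P \<longleftrightarrow> x \<in> P" if "r \<noteq> 0" for r x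
    using scale[of "inverse r" "r *\<^sub>R x"] scale[of r x] that by auto
  have no_line: "\<not> L \<subseteq> D" and connected_line: "connected (D \<inter> L)" if "proj_line L" for L
    using \<open>proj_convex D\<close> that by (auto simp: proj_convex_def)
  have both_line: False
    if seg: "closed_segment u x \<subseteq> P" "closed_segment u (- x) \<subseteq> P" for u x
  proof -
    \<comment> \<open>Coefficients of equal sign give a nonzero multiple, by \<open>a + b\<close>,
      of a point of the segment.\<close>
    have comb: "a *\<^sub>R u + b *\<^sub>R x \<in> P" if "a *\<^sub>R u + b *\<^sub>R x \<noteq> 0" "a * b \<ge> 0"
      and "closed_segment u x \<subseteq> P" for a b x
    proof -
      have *: "a + b \<noteq> 0"
      proof
        assume "a + b = 0"
        then have "b = - a"
          by simp
        then show False
          using that(1,2) by (auto simp: mult_le_0_iff)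
      qed
      have "a / (a + b) \<ge> 0" "b / (a + b) \<ge> 0"
        using that(2) * by (auto simp: zero_le_divide_iff zero_le_mult_iff)
      moreover have "a / (a + b) + b / (a + b) = 1"
        using * by (simp flip: add_divide_distrib)
      ultimately have "(a / (a + b)) *\<^sub>R u + (b / (a + b)) *\<^sub>R x \<in> closed_segment u x"
        unfolding closed_segment_def by (force intro!: exI[of _ "b / (a + b)"])
      then have "(a + b) *\<^sub>R ((a / (a + b)) *\<^sub>R u + (b / (a + b)) *\<^sub>R x) \<in> P"
        using scale * that(3) by blast
      then show ?thesis
        using * by (simp add: scaleR_right_distrib)
    qed
    have "x \<noteq> c *\<^sub>R u" for c
    proof
      assume x: "x = c *\<^sub>R u"
      \<comment> \<open>With weight \<open>1 / (1 + \<bar>c\<bar>)\<close> at the far end the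
        combination cancels: on the segment to \<open>- x\<close> if \<open>c \<ge> 0\<close>, on
        the one to \<open>x\<close> otherwise.\<close>
      have "0 \<in> closed_segment u x \<or> 0 \<in> closed_segment u (- x)"
      proof (cases "c \<ge> 0")
        case True
        then have "0 = (1 - 1 / (1 + c)) *\<^sub>R u + (1 / (1 + c)) *\<^sub>R - x"
          unfolding x by (simp add: field_simps flip: scaleR_diff_left)
        moreover have "0 \<le> 1 / (1 + c)" "1 / (1 + c) \<le> 1"
          using True by simp_all
        ultimately show ?thesis
          unfolding in_segment by blast
      next
        case False
        then have "0 = (1 - 1 / (1 - c)) *\<^sub>R u + (1 / (1 - c)) *\<^sub>R x"
          unfolding x by (simp add: field_simps flip: scaleR_add_left)
        moreover have "0 \<le> 1 / (1 - c)" "1 / (1 - c) \<le> 1"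
          using False by simp_all
        ultimately show ?thesis
          unfolding in_segment by blast
      qed
      then show False
        using seg \<open>0 \<notin> P\<close> by blast
    qed
    moreover have "u \<noteq> 0"
      using seg(1) \<open>0 \<notin> P\<close> by auto
    ultimately have "proj_line (proj_pt ` ({a *s u + b *s x |a b. True} - {0}))"
      by (intro proj_line_span) (auto simp: scalar_mult_eq_scaleR)
    moreover have "a *\<^sub>R u + b *\<^sub>R x \<in> P" if "a *\<^sub>R u + b *\<^sub>R x \<noteq> 0" for a b
    proof (cases "a * b \<ge> 0")
      case True
      then show ?thesis using comb seg(1) that by blast
    next
      case False
      then show ?thesis using comb[of a "- b" "- x"] seg(2) that by simp
    qed
    then have "proj_pt ` ({a *s u + b *s x |a b. True} - {0}) \<subseteq> D"
      by (auto simp: P_def scalar_mult_eq_scaleR)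
    ultimately show False
      using no_line by blast
  qed
  have some_segment: "closed_segment u x \<subseteq> P \<or> closed_segment u (- x) \<subseteq> P" if "u \<in> P" "x \<in> P" for u x
  proof (rule ccontr)
    assume "\<not> ?thesis"
    then obtain p q where "p \<in> closed_segment u x" "q \<in> closed_segment u (- x)" and pq: "p \<notin> P" "q \<notin> P"
      by blast
    then obtain s t where s: "0 \<le> s" "s \<le> 1" "p = (1 - s) *\<^sub>R u + s *\<^sub>R x"
      and t: "0 \<le> t" "t \<le> 1" "q = (1 - t) *\<^sub>R u + t *\<^sub>R - x"
      by (auto simp: in_segment)
    have "s \<noteq> 0" "s \<noteq> 1"
      using that pq s by auto
    have "t \<noteq> 0" "t \<noteq> 1"
      using that pq t scale[of "-1" x] by auto
    have st: "0 < s" "s < 1" "0 < t" "t < 1"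
      using s t \<open>s \<noteq> 0\<close> \<open>s \<noteq> 1\<close> \<open>t \<noteq> 0\<close> \<open>t \<noteq> 1\<close> by auto
    have "u \<noteq> 0"
      using that \<open>0 \<notin> P\<close> by auto
    \<comment> \<open>If \<open>x\<close> were a multiple of \<open>u\<close>, so would be
      \<open>p\<close> and \<open>q\<close>. Lying outside \<open>P\<close>, both would have to
      vanish, but for either sign of \<open>c\<close> one of their coefficients is positive.\<close>
    have indep: "x \<noteq> c *\<^sub>R u" for c
    proof
      assume x: "x = c *\<^sub>R u"
      then have "c \<noteq> 0"
        using that(2) \<open>0 \<notin> P\<close> by auto
      have p: "p = (1 - s + s * c) *\<^sub>R u" and q: "q = (1 - t - t * c) *\<^sub>R u"
        using s t x by (simp_all add: algebra_simps)
      have "1 - s + s * c = 0" "1 - t - t * c = 0"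
        using pq that(1) scale unfolding p q by blast+
      moreover have "1 - s + s * c > 0" if "c > 0"
        using st that by (simp add: add_pos_pos)
      moreover have "1 - t - t * c > 0" if "c < 0"
        using st that mult_pos_neg[of t c] by linarith
      ultimately show False
        using \<open>c \<noteq> 0\<close> by linarith
    qed
    define \<Delta> where "\<Delta> = (u \<bullet> u) * (x \<bullet> x) - (u \<bullet> x)\<^sup>2"
    have "\<Delta> > 0"
      unfolding \<Delta>_def using Gram_determinant_pos[OF \<open>u \<noteq> 0\<close>] indep by blast
    \<comment> \<open>By Cramer's rule \<open>\<phi>\<close> and \<open>\<psi>\<close> are the
      coordinates with respect to \<open>u\<close> and \<open>x\<close>, multiplied by \<Delta>.
      Written with inner products, they are defined and continuous on the whole space, not only on
      the plane.\<close>
    define \<phi> where "\<phi> y = (y \<bullet> u) * (x \<bullet> x) - (y \<bullet> x) * (u \<bullet> x)" for y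
    define \<psi> where "\<psi> y = (y \<bullet> x) * (u \<bullet> u) - (y \<bullet> u) * (u \<bullet> x)" for y
    have \<phi>: "\<phi> (a *\<^sub>R u + b *\<^sub>R x) = a * \<Delta>" and \<psi>: "\<psi> (a *\<^sub>R u + b *\<^sub>R x) = b * \<Delta>" for a b
      by (simp_all add: \<phi>_def \<psi>_def \<Delta>_def inner_add_left inner_commute power2_eq_square algebra_simps)
    \<comment> \<open>On the plane of \<open>u\<close> and \<open>x\<close>, the quadratic form \<open>Q\<close> vanishes exactly on the lines through \<open>p\<close> and \<open>q\<close>,
      which miss \<open>P\<close>; its sign separates \<open>u\<close> from \<open>x\<close>.\<close>
    define Q where "Q y = (s * \<phi> y - (1 - s) * \<psi> y) * (t * \<phi> y + (1 - t) * \<psi> y)" for y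
    have Q_scale: "Q (c *s y) = c\<^sup>2 * Q y" for c y
      by (simp add: Q_def \<phi>_def \<psi>_def scalar_mult_eq_scaleR power2_eq_square algebra_simps)
    have Q_comb: "Q (a *\<^sub>R u + b *\<^sub>R x) = (s * a - (1 - s) * b) * (t * a + (1 - t) * b) * \<Delta>\<^sup>2" for a b
      by (simp add: Q_def \<phi> \<psi> power2_eq_square algebra_simps)
    have Q_nz: "Q y \<noteq> 0" if "y \<in> P" "y = a *\<^sub>R u + b *\<^sub>R x" for y a b
    proof
      assume "Q y = 0"
      then have "(s * a - (1 - s) * b) * (t * a + (1 - t) * b) = 0"
        using \<open>\<Delta> > 0\<close> that(2) Q_comb[of a b] by auto
      then consider "s * a - (1 - s) * b = 0" | "t * a + (1 - t) * b = 0"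
        using mult_eq_0_iff by blast
      then show False
      proof cases
        case 1
        then have "a = b / s * (1 - s)"
          using st by (simp add: field_simps)
        then have y: "y = (b / s) *\<^sub>R p"
          using st that(2) s(3) by (simp add: scaleR_right_distrib)
        then have "b / s \<noteq> 0"
          using \<open>y \<in> P\<close> \<open>0 \<notin> P\<close> by (metis scaleR_zero_left)
        then show False
          using scale_iff pq y \<open>y \<in> P\<close> by blast
      next
        case 2
        then have "t * a = - b * (1 - t)"
          by (simp add: algebra_simps)
        then have "a = - b / t * (1 - t)"
          using st by (simp add: field_simps)
        then have y: "y = (- b / t) *\<^sub>R q"
          using st that(2) t(3) by (simp add: scaleR_right_diff_distrib)
        then have "- b / t \<noteq> 0"
          using \<open>y \<in> P\<close> \<open>0 \<notin> P\<close> by (metis scaleR_zero_left)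
        then show False
          using scale_iff pq y \<open>y \<in> P\<close> by blast
      qed
    qed
    let ?L = "proj_pt ` ({a *s u + b *s x |a b. True} - {0})"
    have "proj_line ?L"
      using \<open>u \<noteq> 0\<close> indep by (intro proj_line_span) (auto simp: scalar_mult_eq_scaleR)
    then have conn: "connected (D \<inter> ?L)"
      by (rule connected_line)
    have contQ: "continuous_on UNIV Q"
      unfolding Q_def \<phi>_def \<psi>_def by (intro continuous_intros)
    have opens: "open {y. y \<noteq> 0 \<and> Q y > 0}" "open {y. y \<noteq> 0 \<and> Q y < 0}"
      using contQ by (auto intro!: open_Collect_conj open_Collect_neq open_Collect_less continuous_intros)
    \<comment> \<open>\<open>Q\<close> is homogeneous of even degree, so its sign depends only on
      the projective point and defines two disjoint open sets of projective space.\<close>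
    have Q_sgn: "Q (c *s y) > 0 \<longleftrightarrow> Q y > 0" "Q (c *s y) < 0 \<longleftrightarrow> Q y < 0" if "c \<noteq> 0" for c y
      using that by (auto simp: Q_scale zero_less_mult_iff mult_less_0_iff)
    have pos: "open {proj_pt y |y. y \<noteq> 0 \<and> Q y > 0}"
        "\<And>y. y \<noteq> 0 \<Longrightarrow> proj_pt y \<in> {proj_pt y |y. y \<noteq> 0 \<and> Q y > 0} \<longleftrightarrow> Q y > 0"
      using open_proj_space_Collect[of "\<lambda>y. Q y > 0", OF opens(1)] Q_sgn(1) by blast+
    have neg: "open {proj_pt y |y. y \<noteq> 0 \<and> Q y < 0}"
        "\<And>y. y \<noteq> 0 \<Longrightarrow> proj_pt y \<in> {proj_pt y |y. y \<noteq> 0 \<and> Q y < 0} \<longleftrightarrow> Q y < 0"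
      using open_proj_space_Collect[of "\<lambda>y. Q y < 0", OF opens(2)] Q_sgn(2) by blast+
    have "D \<inter> ?L \<subseteq> {proj_pt y |y. y \<noteq> 0 \<and> Q y > 0} \<union> {proj_pt y |y. y \<noteq> 0 \<and> Q y < 0}"
    proof
      fix r assume "r \<in> D \<inter> ?L"
      then obtain a b where r: "r = proj_pt (a *\<^sub>R u + b *\<^sub>R x)" "a *\<^sub>R u + b *\<^sub>R x \<noteq> 0" "r \<in> D"
        by (auto simp: scalar_mult_eq_scaleR)
      then have "Q (a *\<^sub>R u + b *\<^sub>R x) \<noteq> 0"
        by (intro Q_nz) (auto simp: P_def)
      then show "r \<in> {proj_pt y |y. y \<noteq> 0 \<and> Q y > 0} \<union> {proj_pt y |y. y \<noteq> 0 \<and> Q y < 0}"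
        using r by (auto simp: neq_iff)
    qed
    moreover have "{proj_pt y |y. y \<noteq> 0 \<and> Q y > 0} \<inter> {proj_pt y |y. y \<noteq> 0 \<and> Q y < 0} \<inter> (D \<inter> ?L) = {}"
      using pos(2) neg(2) by fastforce
    moreover have "proj_pt u \<in> {proj_pt y |y. y \<noteq> 0 \<and> Q y > 0}"
      using pos(2)[OF \<open>u \<noteq> 0\<close>] Q_comb[of 1 0] st \<open>\<Delta> > 0\<close> by simp
    moreover have "x \<noteq> 0"
      using that \<open>0 \<notin> P\<close> by auto
    then have "proj_pt x \<in> {proj_pt y |y. y \<noteq> 0 \<and> Q y < 0}"
      using neg(2)[OF \<open>x \<noteq> 0\<close>] Q_comb[of 0 1] st \<open>\<Delta> > 0\<close> by (simp add: mult_less_0_iff)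
    moreover have "u = 1 *s u + 0 *s x" "x = 0 *s u + 1 *s x"
      by simp_all
    then have "u \<in> {a *s u + b *s x |a b. True} - {0}" "x \<in> {a *s u + b *s x |a b. True} - {0}"
      using \<open>u \<noteq> 0\<close> \<open>x \<noteq> 0\<close> by blast+
    then have "proj_pt u \<in> D \<inter> ?L" "proj_pt x \<in> D \<inter> ?L"
      using that by (simp_all add: P_def)
    ultimately show False
      using connectedD[OF conn pos(1) neg(1)] by blast
  qed
  show thesis
  proof (rule convex_cone_of_symmetric_set[OF \<open>open P\<close> \<open>0 \<notin> P\<close> scale some_segment both_line])
    fix C assume "open C" "convex C" "0 \<notin> C" "\<And>r x. r > 0 \<Longrightarrow> x \<in> C \<Longrightarrow> r *\<^sub>R x \<in> C"
      and "\<And>x. x \<in> P \<longleftrightarrow> x \<in> C \<or> - x \<in> C"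
    then show thesis
      using that unfolding P_def by blast
  qed
qed

subsection \<open>Tube domains\<close>

definition Re_vec :: "complex ^ 'n \<Rightarrow> real ^ 'n" where
  "Re_vec z = (\<chi> i. Re (z $ i))"

definition Im_vec :: "complex ^ 'n \<Rightarrow> real ^ 'n" where
  "Im_vec z = (\<chi> i. Im (z $ i))"

text \<open>Not the classical tube with one free component: it is the intersection of the tubes over
  \<open>C\<close> in the real and in the imaginary direction.\<close>

definition tube_domain :: "(real ^ 'n) set \<Rightarrow> (complex ^ 'n) set" where
  "tube_domain C = {z. Re_vec z \<in> C \<and> Im_vec z \<in> C}"

lemma linear_Re_vec: "linear Re_vec" and linear_Im_vec: "linear Im_vec"
  by (auto intro!: linearI simp: Re_vec_def Im_vec_def vec_eq_iff)

lemma Re_vec_zero: "Re_vec 0 = 0"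
  by (rule linear_0[OF linear_Re_vec])

lemma Re_vec_add: "Re_vec (y + z) = Re_vec y + Re_vec z"
  and Im_vec_add: "Im_vec (y + z) = Im_vec y + Im_vec z"
  by (auto simp: Re_vec_def Im_vec_def vec_eq_iff)

lemma Re_vec_scale: "Re_vec (c *s z) = Re c *\<^sub>R Re_vec z - Im c *\<^sub>R Im_vec z"
  and Im_vec_scale: "Im_vec (c *s z) = Re c *\<^sub>R Im_vec z + Im c *\<^sub>R Re_vec z"
  by (auto simp: Re_vec_def Im_vec_def vec_eq_iff)

lemma Re_vec_complexify [simp]: "Re_vec (complexify v) = v"
  and Im_vec_complexify [simp]: "Im_vec (complexify v) = 0"
  by (auto simp: Re_vec_def Im_vec_def complexify_def vec_eq_iff)

lemma complex_vec_eq: "z = complexify (Re_vec z) + \<i> *s complexify (Im_vec z)"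
  by (simp add: complexify_def Re_vec_def Im_vec_def vec_eq_iff complex_eq_iff)

lemma open_tube_domain:
  assumes "open C" shows "open (tube_domain C)"
proof -
  have "continuous_on UNIV Re_vec" "continuous_on UNIV Im_vec"
    unfolding Re_vec_def Im_vec_def by (intro continuous_intros)+
  then have "open (Re_vec -` C)" "open (Im_vec -` C)"
    using assms by (auto simp: continuous_on_open_vimage)
  moreover have "tube_domain C = Re_vec -` C \<inter> Im_vec -` C"
    by (auto simp: tube_domain_def)
  ultimately show ?thesis
    by auto
qed

lemma convex_tube_domain:
  assumes "convex C" shows "convex (tube_domain C)"
proof -
  have "tube_domain C = Re_vec -` C \<inter> Im_vec -` C"
    by (auto simp: tube_domain_def)
  then show ?thesis
    using assms linear_Re_vec linear_Im_vec by (auto intro!: convex_Int convex_linear_vimage)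
qed

text \<open>The complex linear extension of the functional \<open>a \<bullet> x\<close>; there is no
  conjugation, so its zero set is a complex subspace.\<close>

definition cdot :: "real ^ 'n \<Rightarrow> complex ^ 'n \<Rightarrow> complex" where
  "cdot a z = (\<Sum>i\<in>UNIV. complex_of_real (a $ i) * z $ i)"

lemma Re_cdot: "Re (cdot a z) = a \<bullet> Re_vec z"
  by (simp add: cdot_def Re_vec_def inner_vec_def)

lemma cdot_scale: "cdot a (c *s z) = c * cdot a z"
  by (simp add: cdot_def sum_distrib_left algebra_simps)

lemma cdot_diff: "cdot a (y - z) = cdot a y - cdot a z"
  by (simp add: cdot_def sum_subtractf algebra_simps)

lemma continuous_on_cdot [continuous_intros]: "continuous_on S (cdot a)"
  unfolding cdot_def by (intro continuous_intros)

text \<open>Separation from the origin gives only a weak inequality. Openness leaves room to step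
  from \<open>x\<close> in the direction \<open>- a\<close>, which makes it strict.\<close>

lemma convex_functional_pos:
  fixes C :: "'a::euclidean_space set"
  assumes "open C" "convex C" "0 \<notin> C"
  obtains a where "\<And>x. x \<in> C \<Longrightarrow> a \<bullet> x > 0"
proof -
  obtain a where "a \<noteq> 0" and a: "\<And>x. x \<in> C \<Longrightarrow> 0 \<le> a \<bullet> x"
    using separating_hyperplane_set_0[OF assms(2,3)] by blast
  have "a \<bullet> x > 0" if x: "x \<in> C" for x
  proof -
    obtain e where "e > 0" "cball x e \<subseteq> C"
      using \<open>open C\<close> x open_contains_cball by blast
    then have "x - (e / norm a) *\<^sub>R a \<in> C"
      using \<open>a \<noteq> 0\<close> by (auto simp: dist_norm)
    then have "0 \<le> a \<bullet> (x - (e / norm a) *\<^sub>R a)"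
      by (rule a)
    then have "(e / norm a) * (a \<bullet> a) \<le> a \<bullet> x"
      by (simp add: inner_diff_right)
    moreover have "(e / norm a) * (a \<bullet> a) > 0"
      using \<open>e > 0\<close> \<open>a \<noteq> 0\<close> by simp
    ultimately show ?thesis
      by linarith
  qed
  then show thesis
    using that by blast
qed

lemma plane_meets_kernel:
  fixes W :: "(complex ^ 'n::finite) set"
  assumes "vec.subspace W" "vec.dim W = 2"
  obtains z where "z \<in> W" "z \<noteq> 0" "cdot a z = 0"
proof -
  obtain B where B: "B \<subseteq> W" "vec.independent B" "card B = 2"
    using vec.basis_exists[of W] assms(2) by metis
  then obtain u v where uv: "B = {u, v}" "u \<noteq> v"
    by (auto simp: card_2_iff)
  then have "u \<noteq> 0"
    using B(2) vec.dependent_zero by blast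
  show thesis
  proof (cases "cdot a u = 0")
    case True
    then show ?thesis
      using that \<open>u \<noteq> 0\<close> B(1) uv(1) by blast
  next
    case False
    \<comment> \<open>The multiple of \<open>u\<close> is chosen to cancel the value of the
      functional at \<open>v\<close>; independence keeps \<open>z\<close> nonzero.\<close>
    define z where "z = v - (cdot a v / cdot a u) *s u"
    have "v \<notin> vec.span {u}"
      using B(2) uv vec.independent_insert[of v "{u}"] by (auto simp: insert_commute)
    then have "z \<noteq> 0"
      by (auto simp: z_def vec.span_singleton)
    moreover have "z \<in> W"
      unfolding z_def using assms(1) B(1) uv(1)
      by (intro vec.subspace_diff vec.subspace_scale) auto
    moreover have "cdot a z = 0"
      using False by (simp add: z_def cdot_diff cdot_scale)
    ultimately show ?thesis
      using that by blast
  qed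
qed

section \<open>Continuous sections over the projected tube, and its intersections with lines\<close>

context
  fixes C :: "(real ^ 'n::finite) set"
  assumes open_C: "open C" and convex_C: "convex C" and zero_C: "0 \<notin> C"
begin

lemma tube_domain_nonzero: "z \<in> tube_domain C \<Longrightarrow> z \<noteq> 0"
  using zero_C by (auto simp: tube_domain_def Re_vec_zero)

text \<open>Normalizing by a functional without zeros on the tube gives a continuous representative
  \<open>\<kappa> p\<close>, which need not lie in the tube. A continuously selected scalar then
  moves it there.\<close>

lemma tube_domain_section:
  obtains \<sigma> where "continuous_on (proj_pt ` tube_domain C) \<sigma>"
    "\<And>z. z \<in> tube_domain C \<Longrightarrow> \<sigma> (proj_pt z) \<in> tube_domain C \<and> (\<exists>c. c \<noteq> 0 \<and> \<sigma> (proj_pt z) = c *s z)"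
proof -
  let ?T = "tube_domain C"
  obtain a where a: "\<And>x. x \<in> C \<Longrightarrow> a \<bullet> x > 0"
    using convex_functional_pos[OF open_C convex_C zero_C] by blast
  have cdot_nz: "cdot a z \<noteq> 0" if "z \<in> ?T" for z
    using a[of "Re_vec z"] that Re_cdot[of a z] by (auto simp: tube_domain_def)
  \<comment> \<open>This expression has degree zero in the representative, so the arbitrary choice
    made by \<open>proj_rep\<close> does not matter.\<close>
  define \<kappa> where "\<kappa> p = inverse (cdot a (proj_rep p)) *s proj_rep p" for p :: "(complex, 'n) proj_space"
  have \<kappa>: "\<kappa> (proj_pt z) = inverse (cdot a z) *s z" if "z \<noteq> 0" for z
  proof -
    have nz: "proj_rep (proj_pt z) \<noteq> 0"
      using Quotient3_rep_reflp[OF Quotient3_proj_space, of "proj_pt z"] by (rule conjunct1)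
    have "proj_pt z = proj_pt (proj_rep (proj_pt z))"
      by (rule Quotient3_abs_rep[OF Quotient3_proj_space, symmetric])
    from proj_pt_eq_iff[OF that nz, THEN iffD1, OF this]
    obtain c where "c \<noteq> 0" "proj_rep (proj_pt z) = c *s z"
      by blast
    then show ?thesis
      by (simp add: \<kappa>_def cdot_scale)
  qed
  define U where "U = {proj_pt z |z. z \<noteq> 0 \<and> cdot a z \<noteq> 0}"
  have "open {z. z \<noteq> 0 \<and> cdot a z \<noteq> 0}"
    by (intro open_Collect_conj open_Collect_neq continuous_intros)
  then have U: "open U" "\<And>z. z \<noteq> 0 \<Longrightarrow> proj_pt z \<in> U \<longleftrightarrow> cdot a z \<noteq> 0"
    unfolding U_def by (rule open_proj_space_Collect; simp add: cdot_scale)+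
  have "continuous_on {z. z \<noteq> 0 \<and> proj_pt z \<in> U} (\<lambda>z. inverse (cdot a z) *s z)"
    unfolding vector_scalar_mult_def using U(2) by (intro continuous_intros) auto
  then have "continuous_on {z. z \<noteq> 0 \<and> proj_pt z \<in> U} (\<lambda>z. \<kappa> (proj_pt z))"
    by (rule continuous_on_eq) (simp add: \<kappa>)
  then have cont_\<kappa>: "continuous_on U \<kappa>"
    using U(1) continuous_on_proj_space by blast
  define Z where "Z = {z. \<exists>c. c *s z \<in> ?T}"
  \<comment> \<open>The selection is made over vectors, which form a metric space, and is pulled
    back along \<open>\<kappa>\<close>. Each \<open>\<Phi> z\<close> is convex as a linear preimage
    of the tube, and by openness of the tube a scalar that works at \<open>z\<close> works
    nearby.\<close>
  define \<Phi> where "\<Phi> z = {c. c *s z \<in> ?T}" for z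
  have "convex (\<Phi> z)" for z
  proof -
    have "linear (\<lambda>c. c *s z)"
      by (auto intro!: linearI simp: vec_eq_iff algebra_simps)
    then have "convex ((\<lambda>c. c *s z) -` ?T)"
      using convex_tube_domain[OF convex_C] by (simp add: convex_linear_vimage)
    then show ?thesis
      by (simp add: \<Phi>_def vimage_def)
  qed
  moreover have "\<exists>V c. open V \<and> z \<in> V \<and> (\<forall>y\<in>Z \<inter> V. c \<in> \<Phi> y)" if z: "z \<in> Z" for z
  proof -
    obtain c where c: "c *s z \<in> ?T"
      using z by (auto simp: Z_def)
    have "continuous_on UNIV (\<lambda>y :: complex ^ 'n. c *s y)"
      unfolding vector_scalar_mult_def by (intro continuous_intros)
    then have "open ((\<lambda>y. c *s y) -` ?T)"
      using open_tube_domain[OF open_C] by (auto simp: continuous_on_open_vimage)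
    then show ?thesis
      using c by (intro exI[of _ "(\<lambda>y. c *s y) -` ?T"] exI[of _ c]) (auto simp: \<Phi>_def)
  qed
  ultimately obtain f where cont_f: "continuous_on Z f" and f: "\<And>z. z \<in> Z \<Longrightarrow> f z \<in> \<Phi> z"
    using continuous_selection[of Z \<Phi>] by metis
  have T_U: "proj_pt ` ?T \<subseteq> U"
    using cdot_nz U(2) tube_domain_nonzero by auto
  have \<kappa>_Z: "\<kappa> (proj_pt z) \<in> Z" if "z \<in> ?T" for z
    using that cdot_nz[OF that] \<kappa>[OF tube_domain_nonzero[OF that]]
    by (auto simp: Z_def intro!: exI[of _ "cdot a z"])
  show thesis
  proof
    have "continuous_on (proj_pt ` ?T) \<kappa>"
      using cont_\<kappa> T_U continuous_on_subset by blast
    moreover from this have "continuous_on (proj_pt ` ?T) (\<lambda>p. f (\<kappa> p))"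
      using \<kappa>_Z by (intro continuous_on_compose2[OF cont_f]) auto
    ultimately show "continuous_on (proj_pt ` ?T) (\<lambda>p. f (\<kappa> p) *s \<kappa> p)"
      unfolding vector_scalar_mult_def by (intro continuous_intros)
    show "f (\<kappa> (proj_pt z)) *s \<kappa> (proj_pt z) \<in> ?T \<and>
        (\<exists>c. c \<noteq> 0 \<and> f (\<kappa> (proj_pt z)) *s \<kappa> (proj_pt z) = c *s z)" if z: "z \<in> ?T" for z
    proof
      show T: "f (\<kappa> (proj_pt z)) *s \<kappa> (proj_pt z) \<in> ?T"
        using f[OF \<kappa>_Z[OF z]] by (simp add: \<Phi>_def)
      have "f (\<kappa> (proj_pt z)) *s \<kappa> (proj_pt z) = (f (\<kappa> (proj_pt z)) * inverse (cdot a z)) *s z"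
        by (simp add: \<kappa>[OF tube_domain_nonzero[OF z]])
      moreover from this have "f (\<kappa> (proj_pt z)) * inverse (cdot a z) \<noteq> 0"
        using tube_domain_nonzero[OF T] by (metis vec.scale_zero_left)
      ultimately show "\<exists>c. c \<noteq> 0 \<and> f (\<kappa> (proj_pt z)) *s \<kappa> (proj_pt z) = c *s z"
        by blast
    qed
  qed
qed

lemma complex_convex_tube_domain: "complex_convex (proj_pt ` tube_domain C)"
  unfolding complex_convex_def
proof (intro conjI allI impI)
  fix L :: "(complex, 'n) proj_space set" assume "proj_line L"
  then obtain W where W: "vec.subspace W" "vec.dim W = 2" and L: "L = proj_pt ` (W - {0})"
    by (auto simp: proj_line_def)
  show "\<not> L \<subseteq> proj_pt ` tube_domain C"
  proof
    assume sub: "L \<subseteq> proj_pt ` tube_domain C"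
    obtain a where a: "\<And>x. x \<in> C \<Longrightarrow> a \<bullet> x > 0"
      using convex_functional_pos[OF open_C convex_C zero_C] by blast
    obtain z where z: "z \<in> W" "z \<noteq> 0" "cdot a z = 0"
      using plane_meets_kernel[OF W] by blast
    then obtain t where t: "t \<in> tube_domain C" "proj_pt z = proj_pt t"
      using sub L by auto
    then obtain c where "t = c *s z"
      using proj_pt_eq_iff[OF z(2) tube_domain_nonzero[OF t(1)]] by blast
    then have "cdot a t = 0"
      using z by (simp add: cdot_scale)
    then show False
      using a[of "Re_vec t"] Re_cdot[of a t] t(1) by (simp add: tube_domain_def)
  qed
next
  fix L :: "(complex, 'n) proj_space set" assume "proj_line L"
  then obtain W where W: "vec.subspace W" and L: "L = proj_pt ` (W - {0})"
    by (auto simp: proj_line_def)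
  let ?T = "tube_domain C"
  \<comment> \<open>A complex subspace contains all multiples of its vectors, so every
    representative in \<open>?T\<close> of a point of \<open>L\<close> already lies in
    \<open>W\<close>.\<close>
  have EL: "proj_pt ` ?T \<inter> L = proj_pt ` (?T \<inter> W)"
  proof (intro set_eqI iffI)
    fix p assume p: "p \<in> proj_pt ` ?T \<inter> L"
    then obtain t where t: "t \<in> ?T" "p = proj_pt t"
      by blast
    have "p \<in> proj_pt ` (W - {0})"
      using p L by blast
    then obtain w where w: "w \<in> W" "w \<noteq> 0" "p = proj_pt w"
      by blast
    have "proj_pt w = proj_pt t"
      using t w by simp
    then obtain c where "t = c *s w"
      using proj_pt_eq_iff[OF w(2) tube_domain_nonzero[OF t(1)]] by blast
    then have "t \<in> W"
      using W w(1) by (simp add: vec.subspace_scale)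
    then show "p \<in> proj_pt ` (?T \<inter> W)"
      using t by blast
  qed (use L tube_domain_nonzero in blast)
  have "convex W"
  proof (rule convexI)
    fix x y :: "complex ^ 'n" and r s :: real
    assume "x \<in> W" "y \<in> W"
    then have "complex_of_real r *s x + complex_of_real s *s y \<in> W"
      using W by (intro vec.subspace_add vec.subspace_scale)
    moreover have "complex_of_real r *s x + complex_of_real s *s y = r *\<^sub>R x + s *\<^sub>R y"
      by (simp add: vec_eq_iff complex_eq_iff)
    ultimately show "r *\<^sub>R x + s *\<^sub>R y \<in> W"
      by simp
  qed
  then have conv: "convex (?T \<inter> W)"
    using convex_tube_domain[OF convex_C] by (simp add: convex_Int)
  have cont: "continuous_on (?T \<inter> W) proj_pt"
    by (rule continuous_on_subset[OF continuous_on_proj_pt]) (use tube_domain_nonzero in auto)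
  show "connected (proj_pt ` ?T \<inter> L)"
    unfolding EL by (intro connected_continuous_image cont convex_connected conv)
  obtain \<sigma> where cont_\<sigma>: "continuous_on (proj_pt ` ?T) \<sigma>"
    and \<sigma>: "\<And>z. z \<in> ?T \<Longrightarrow> \<sigma> (proj_pt z) \<in> ?T \<and> (\<exists>c. c \<noteq> 0 \<and> \<sigma> (proj_pt z) = c *s z)"
    using tube_domain_section by metis
  show "simply_connected (proj_pt ` ?T \<inter> L)"
    unfolding EL
  \<comment> \<open>\<open>\<sigma>\<close> only rescales, so it maps back into \<open>W\<close>;
    with \<open>proj_pt\<close> as its left inverse, simple connectedness passes from the convex set
    to its image.\<close>
  proof (rule simply_connected_retraction_gen)
    show "simply_connected (?T \<inter> W)"
      using conv by (rule convex_imp_simply_connected)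
    show "continuous_on (proj_pt ` (?T \<inter> W)) \<sigma>"
      using cont_\<sigma> by (rule continuous_on_subset) blast
    show "\<sigma> \<in> proj_pt ` (?T \<inter> W) \<rightarrow> ?T \<inter> W"
    proof (rule funcsetI)
      fix p assume "p \<in> proj_pt ` (?T \<inter> W)"
      then obtain z where "z \<in> ?T" "z \<in> W" "p = proj_pt z"
        by blast
      then show "\<sigma> p \<in> ?T \<inter> W"
        using \<sigma>[of z] W by (auto simp: vec.subspace_scale)
    qed
    show "proj_pt (\<sigma> p) = p" if p: "p \<in> proj_pt ` (?T \<inter> W)" for p
    proof -
      obtain z where z: "z \<in> ?T" "p = proj_pt z"
        using p by blast
      then obtain c where "c \<noteq> 0" "\<sigma> p = c *s z"
        using \<sigma>[of z] by blast
      then show ?thesis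
        using z tube_domain_nonzero by (simp add: proj_pt_scale)
    qed
  qed (use cont in auto)
qed

end

subsection \<open>The elliptic tube as a tube domain\<close>

text \<open>Turning the bisector of the angle to the positive real axis puts both numbers into the
  sector \<open>\<bar>Im w\<bar> \<le> Re w\<close>, which multiplication by \<open>1 + \<i>\<close>
  carries to the closed first quadrant. The strict sums ensure that the real and the imaginary
  coefficients do not both vanish in either pair.\<close>

lemma rotate_to_quadrant:
  fixes c0 c1 :: complex
  assumes "Re (c0 * cnj c1) \<ge> 0" "c0 \<noteq> 0 \<or> c1 \<noteq> 0"
  obtains d where "d \<noteq> 0" "Re (d * c0) \<ge> 0" "Im (d * c0) \<ge> 0" "Re (d * c1) \<ge> 0" "Im (d * c1) \<ge> 0"
    "Re (d * c0) + Re (d * c1) > 0" "Im (d * c0) + Im (d * c1) > 0"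
proof -
  obtain b where b: "\<bar>Im (b * c0)\<bar> \<le> Re (b * c0)" "\<bar>Im (b * c1)\<bar> \<le> Re (b * c1)"
    "\<bar>Im (b * c0) + Im (b * c1)\<bar> < Re (b * c0) + Re (b * c1)"
  proof (cases "c0 = 0 \<or> c1 = 0")
    case True
    then show ?thesis
      using assms(2)
      \<comment> \<open>Exactly one coefficient is nonzero, so the witness is its conjugate, which
        makes it real and positive.\<close>
      by (intro that[of "cnj c0 + cnj c1"]) (auto simp: sum_squares_gt_zero_iff complex_eq_iff)
  next
    case False
    define w where "w = c0 * cnj c1"
    define N where "N = cmod c0 * cmod c1"
    have pos: "cmod c0 > 0" "cmod c1 > 0" "N > 0"
      using False by (auto simp: N_def)
    have "Re w \<ge> 0" "\<bar>Im w\<bar> \<le> N"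
      using assms(1) abs_Im_le_cmod[of w] by (simp_all add: w_def N_def norm_mult)
    have sq: "cnj c0 * c0 = (of_real (cmod c0))\<^sup>2" "cnj c1 * c1 = (of_real (cmod c1))\<^sup>2"
      using complex_norm_square[of c0] complex_norm_square[of c1] by (simp_all add: mult.commute)
    have cnj_w: "cnj w = cnj c0 * c1"
      by (simp add: w_def)
    \<comment> \<open>\<open>b\<close> is the conjugate of a bisector of the angle between \<open>c0\<close> and \<open>c1\<close>.\<close>
    define b where "b = of_real (cmod c1) * cnj c0 + of_real (cmod c0) * cnj c1"
    have "b * c0 = of_real (cmod c1) * (cnj c0 * c0) + of_real (cmod c0) * w"
      unfolding b_def w_def by (simp add: algebra_simps)
    then have b0: "b * c0 = of_real (cmod c0) * (of_real N + w)"
      unfolding sq N_def by (simp add: algebra_simps power2_eq_square)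
    have "b * c1 = of_real (cmod c0) * (cnj c1 * c1) + of_real (cmod c1) * cnj w"
      unfolding b_def cnj_w by (simp add: algebra_simps)
    then have b1: "b * c1 = of_real (cmod c1) * (of_real N + cnj w)"
      unfolding sq N_def by (simp add: algebra_simps power2_eq_square)
    have ReIm: "Re (b * c0) = cmod c0 * (N + Re w)" "Im (b * c0) = cmod c0 * Im w"
      "Re (b * c1) = cmod c1 * (N + Re w)" "Im (b * c1) = - (cmod c1 * Im w)"
      unfolding b0 b1 by simp_all
    have bounds: "\<bar>Im (b * c0)\<bar> \<le> Re (b * c0)" "\<bar>Im (b * c1)\<bar> \<le> Re (b * c1)"
      unfolding ReIm using \<open>Re w \<ge> 0\<close> \<open>\<bar>Im w\<bar> \<le> N\<close> by (auto simp: abs_mult intro!: mult_left_mono)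
    have Re_pos: "Re (b * c0) > 0" "Re (b * c1) > 0"
      unfolding ReIm using pos \<open>Re w \<ge> 0\<close> by (simp_all add: add_pos_nonneg)
    \<comment> \<open>The two imaginary parts have opposite signs, so their sum is bounded by the
      larger of the two real parts, which is less than the sum of both.\<close>
    have "Im w \<ge> 0 \<Longrightarrow> Im (b * c0) \<ge> 0 \<and> Im (b * c1) \<le> 0"
      "Im w \<le> 0 \<Longrightarrow> Im (b * c0) \<le> 0 \<and> Im (b * c1) \<ge> 0"
      unfolding ReIm using pos by (simp_all add: mult_le_0_iff)
    then have "\<bar>Im (b * c0) + Im (b * c1)\<bar> < Re (b * c0) + Re (b * c1)"
      using bounds Re_pos by linarith
    then show ?thesis
      using that bounds by blast
  qed
  have "(1 + \<i>) * b * c = (1 + \<i>) * (b * c)" for c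
    by (simp add: mult.assoc)
  then have ReIm: "Re ((1 + \<i>) * b * c) = Re (b * c) - Im (b * c)"
      "Im ((1 + \<i>) * b * c) = Re (b * c) + Im (b * c)" for c
    by (simp_all add: algebra_simps)
  have "b \<noteq> 0"
    using b(3) by auto
  moreover have "1 + \<i> \<noteq> 0"
    by (simp add: complex_eq_iff)
  ultimately have "(1 + \<i>) * b \<noteq> 0"
    by simp
  then show thesis
    by (rule that; unfold ReIm; use b in linarith)
qed

lemma convex_cone_comb:
  fixes C :: "'a::real_vector set"
  assumes "convex C" "\<And>r x. r > 0 \<Longrightarrow> x \<in> C \<Longrightarrow> r *\<^sub>R x \<in> C"
    and "x \<in> C" "y \<in> C" "a \<ge> 0" "b \<ge> 0" "a + b > 0"
  shows "a *\<^sub>R x + b *\<^sub>R y \<in> C"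
proof -
  have "(a / (a + b)) *\<^sub>R x + (b / (a + b)) *\<^sub>R y \<in> C"
    using assms by (intro convexD) (auto simp flip: add_divide_distrib)
  then have "(a + b) *\<^sub>R ((a / (a + b)) *\<^sub>R x + (b / (a + b)) *\<^sub>R y) \<in> C"
    using assms by blast
  then show ?thesis
    using assms(7) by (simp add: scaleR_right_distrib)
qed

lemma exists_not_proportional:
  fixes x :: "'a::euclidean_space"
  assumes "DIM('a) \<ge> 2"
  obtains w where "\<And>c. w \<noteq> c *\<^sub>R x"
proof -
  have "dim (span {x}) < DIM('a)"
    using assms dim_le_card'[of "{x}"] by (simp add: dim_span)
  then have "span {x} \<noteq> UNIV"
    by (metis dim_UNIV less_irrefl)
  then show thesis
    using that by (auto simp: span_singleton)
qed

text \<open>From left to right, a segment in \<open>D\<close> lifts into one of the cones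
  \<open>C\<close> and \<open>- C\<close>, and rotating the coefficients makes the real and the
  imaginary part combinations in \<open>C\<close>. Conversely, the real and the imaginary part of
  \<open>z\<close> span a segment whose disk contains its point, unless they are
  proportional.\<close>

lemma elliptic_tube_eq_tube_domain:
  fixes D :: "(real, 'n::finite) proj_space set"
  assumes card: "CARD('n) \<ge> 2"
    and open_C: "open C" and convex_C: "convex C" and zero_C: "0 \<notin> C"
    and scale_C: "\<And>r x. r > 0 \<Longrightarrow> x \<in> C \<Longrightarrow> r *\<^sub>R x \<in> C"
    and D: "\<And>v. v \<noteq> 0 \<Longrightarrow> proj_pt v \<in> D \<longleftrightarrow> v \<in> C \<or> - v \<in> C"
  shows "elliptic_tube D = proj_pt ` tube_domain C"
proof (intro set_eqI iffI)
  have uminus_C: "- x \<notin> C" if "x \<in> C" for x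
    using convexD[OF convex_C that, of "- x" "1/2" "1/2"] zero_C by auto
  have comb_C: "a *\<^sub>R x + b *\<^sub>R y \<in> C"
    if "x \<in> C" "y \<in> C" "a \<ge> 0" "b \<ge> 0" "a + b > 0" for a b x y
    using convex_cone_comb[of C x y a b] convex_C scale_C that by blast
  fix p
  {
    assume "p \<in> elliptic_tube D"
    then obtain v0 v1 where v: "v0 \<noteq> 0" "v1 \<noteq> 0" "proj_pt v0 \<noteq> proj_pt v1" "proj_segment v0 v1 \<subseteq> D"
      and "p \<in> segment_disk v0 v1"
      by (auto simp: elliptic_tube_def)
    then obtain c0 c1 where p: "p = proj_pt (c0 *s complexify v0 + c1 *s complexify v1)"
      and nz: "c0 *s complexify v0 + c1 *s complexify v1 \<noteq> 0" and c: "Re (c0 * cnj c1) \<ge> 0"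
      by (auto simp: segment_disk_def)
    have seg: "closed_segment v0 v1 \<subseteq> C \<union> uminus ` C"
    proof
      fix y assume "y \<in> closed_segment v0 v1"
      then obtain t where t: "0 \<le> t" "t \<le> 1" "y = (1 - t) *s v0 + t *s v1"
        by (auto simp: in_segment scalar_mult_eq_scaleR)
      \<comment> \<open>A zero on the segment would make the endpoints proportional, hence equal as
        projective points.\<close>
      have "y \<noteq> 0"
      proof
        assume "y = 0"
        then have eq: "(1 - t) *\<^sub>R v0 = - (t *\<^sub>R v1)"
          using t(3) by (simp add: scalar_mult_eq_scaleR eq_neg_iff_add_eq_0)
        then have "t \<noteq> 0" "1 - t \<noteq> 0"
          using v by auto
        have "((1 - t) / t) *\<^sub>R v0 = (1 / t) *\<^sub>R ((1 - t) *\<^sub>R v0)"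
          by simp
        also have "\<dots> = - v1"
          unfolding eq using \<open>t \<noteq> 0\<close> by simp
        finally have "v1 = (- ((1 - t) / t)) *\<^sub>R v0"
          unfolding scaleR_minus_left by simp
        moreover have "- ((1 - t) / t) \<noteq> 0"
          using \<open>t \<noteq> 0\<close> \<open>1 - t \<noteq> 0\<close> by simp
        ultimately show False
          using v(3) proj_pt_eq_iff[OF v(1,2)] unfolding scalar_mult_eq_scaleR by blast
      qed
      moreover have "0 \<le> (1 - t) * t"
        using t by simp
      then have "proj_pt y \<in> D"
        using v(4) t(3) \<open>y \<noteq> 0\<close> unfolding proj_segment_def by blast
      ultimately show "y \<in> C \<union> uminus ` C"
        using D by force
    qed
    have "closed_segment v0 v1 \<subseteq> C \<or> closed_segment v0 v1 \<subseteq> uminus ` C"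
    proof -
      have "open (uminus ` C)"
        using open_C by (rule open_negations)
      moreover have "C \<inter> uminus ` C \<inter> closed_segment v0 v1 = {}"
        using uminus_C by auto
      ultimately have "C \<inter> closed_segment v0 v1 = {} \<or> uminus ` C \<inter> closed_segment v0 v1 = {}"
        using connectedD[OF connected_segment(1) open_C _ _ seg] by blast
      then show ?thesis
        using seg by blast
    qed
    then consider "v0 \<in> C" "v1 \<in> C" | "- v0 \<in> C" "- v1 \<in> C"
      by force
    \<comment> \<open>\<open>e\<close> is the common sign, 1 or -1, that moves both endpoints into
      \<open>C\<close>; it is absorbed into the scalar of the projective point.\<close>
    then obtain w0 w1 e where w: "w0 \<in> C" "w1 \<in> C" and e: "(e::complex) \<noteq> 0"
      "complexify v0 = e *s complexify w0" "complexify v1 = e *s complexify w1"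
    proof cases
      case 1
      then show ?thesis by (intro that[of v0 v1 1]) auto
    next
      case 2
      then show ?thesis by (intro that[of "- v0" "- v1" "-1"]) (auto simp: complexify_def vec_eq_iff)
    qed
    have "c0 \<noteq> 0 \<or> c1 \<noteq> 0"
      using nz by auto
    then obtain d where d: "d \<noteq> 0"
      "Re (d * c0) \<ge> 0" "Im (d * c0) \<ge> 0" "Re (d * c1) \<ge> 0" "Im (d * c1) \<ge> 0"
      "Re (d * c0) + Re (d * c1) > 0" "Im (d * c0) + Im (d * c1) > 0"
      using rotate_to_quadrant[OF c] by metis
    define z where "z = (d * c0) *s complexify w0 + (d * c1) *s complexify w1"
    have "Re_vec z = Re (d * c0) *\<^sub>R w0 + Re (d * c1) *\<^sub>R w1"
      "Im_vec z = Im (d * c0) *\<^sub>R w0 + Im (d * c1) *\<^sub>R w1"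
      unfolding z_def by (simp_all add: Re_vec_add Im_vec_add Re_vec_scale Im_vec_scale)
    then have "z \<in> tube_domain C"
      using comb_C w d by (simp add: tube_domain_def)
    moreover have "z = (d / e) *s (c0 *s complexify v0 + c1 *s complexify v1)"
      using e by (simp add: z_def vec.scale_right_distrib)
    then have "p = proj_pt z"
      using proj_pt_scale[OF _ nz, of "d / e"] d(1) e(1) p by simp
    ultimately show "p \<in> proj_pt ` tube_domain C"
      by blast
  }
  {
    assume "p \<in> proj_pt ` tube_domain C"
    then obtain z where z: "Re_vec z \<in> C" "Im_vec z \<in> C" and p: "p = proj_pt z"
      by (auto simp: tube_domain_def)
    have tubeI: "p \<in> elliptic_tube D"
      if v: "v0 \<in> C" "v1 \<in> C" "\<And>c. v1 \<noteq> c *\<^sub>R v0"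
        and zc: "z = c0 *s complexify v0 + c1 *s complexify v1" "Re (c0 * cnj c1) \<ge> 0" for v0 v1 c0 c1
    proof -
      have nz: "v0 \<noteq> 0" "v1 \<noteq> 0" "z \<noteq> 0"
        using v z zero_C Re_vec_zero by metis+
      have "proj_segment v0 v1 \<subseteq> D"
      proof
        fix q assume "q \<in> proj_segment v0 v1"
        then obtain a b where q: "q = proj_pt (a *\<^sub>R v0 + b *\<^sub>R v1)" "a *\<^sub>R v0 + b *\<^sub>R v1 \<noteq> 0" "a * b \<ge> 0"
          by (auto simp: proj_segment_def scalar_mult_eq_scaleR)
        then have "a \<noteq> 0 \<or> b \<noteq> 0" "a \<ge> 0 \<and> b \<ge> 0 \<or> a \<le> 0 \<and> b \<le> 0"
          by (auto simp: zero_le_mult_iff)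
        then consider "a \<ge> 0" "b \<ge> 0" "a + b > 0" | "- a \<ge> 0" "- b \<ge> 0" "- a + - b > 0"
          by fastforce
        then have "a *\<^sub>R v0 + b *\<^sub>R v1 \<in> C \<or> - (a *\<^sub>R v0 + b *\<^sub>R v1) \<in> C"
        proof cases
          case 1
          then show ?thesis using comb_C[OF v(1,2)] by blast
        next
          case 2
          then show ?thesis using comb_C[OF v(1,2), of "- a" "- b"] by simp
        qed
        then show "q \<in> D"
          using q D by blast
      qed
      moreover have "proj_pt v0 \<noteq> proj_pt v1"
        using v(3) nz by (simp add: proj_pt_eq_iff scalar_mult_eq_scaleR)
      moreover have "p \<in> segment_disk v0 v1"
        using zc nz(3) p unfolding segment_disk_def by blast
      ultimately show ?thesis
        using nz unfolding elliptic_tube_def by blast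
    qed
    show "p \<in> elliptic_tube D"
    proof (cases "\<exists>c. Im_vec z = c *\<^sub>R Re_vec z")
      case False
      then show ?thesis
        \<comment> \<open>The coefficients 1 and \<i> are perpendicular, so the point lies on the
          boundary case of the disk condition.\<close>
        using z complex_vec_eq[of z] by (intro tubeI[of "Re_vec z" "Im_vec z" 1 \<i>]) auto
    next
      case True
      then obtain c where c: "Im_vec z = c *\<^sub>R Re_vec z"
        by blast
      let ?x = "Re_vec z"
      obtain w where w: "\<And>c. w \<noteq> c *\<^sub>R ?x"
        \<comment> \<open>Here \<open>z\<close> is a complex multiple of the real vector
          \<open>?x\<close>. A second direction yields a short segment in \<open>C\<close> with
          midpoint \<open>?x\<close>, and equal coefficients at its ends recover
          \<open>z\<close>.\<close>
        using exists_not_proportional[of ?x] card by auto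
      then have "w \<noteq> 0"
        by (metis scaleR_zero_left)
      obtain e where "e > 0" and e: "cball ?x e \<subseteq> C"
        using open_C z(1) open_contains_cball by blast
      define y where "y = (e / norm w) *\<^sub>R w"
      have "?x + y \<in> C" "?x - y \<in> C"
        using e \<open>e > 0\<close> \<open>w \<noteq> 0\<close> by (auto simp: y_def dist_norm subset_eq)
      \<comment> \<open>Proportional ends would make \<open>y\<close>, and so \<open>w\<close>, a
        multiple of \<open>?x\<close>, or force \<open>?x\<close> to vanish when
        \<open>k = - 1\<close>.\<close>
      moreover have "?x - y \<noteq> k *\<^sub>R (?x + y)" for k
      proof
        assume *: "?x - y = k *\<^sub>R (?x + y)"
        then have **: "(1 + k) *\<^sub>R y = (1 - k) *\<^sub>R ?x"
          by (simp add: algebra_simps)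
        show False
        proof (cases "1 + k = 0")
          case True
          then have "k = - 1"
            by simp
          then have "2 *\<^sub>R ?x = 0"
            using ** by simp
          then show False
            using z(1) zero_C by auto
        next
          case False
          let ?r = "norm w / e"
          have "w = ?r *\<^sub>R y"
            using \<open>e > 0\<close> \<open>w \<noteq> 0\<close> by (simp add: y_def)
          also have "y = (1 / (1 + k)) *\<^sub>R ((1 + k) *\<^sub>R y)"
            using False by simp
          finally show False
            using w unfolding ** by (metis scaleR_scaleR)
        qed
      qed
      moreover have "z = ((1 + \<i> * of_real c) / 2) *s complexify (?x + y) + ((1 + \<i> * of_real c) / 2) *s complexify (?x - y)"
      proof -
        have "z = complexify ?x + \<i> *s complexify (c *\<^sub>R ?x)"
          using complex_vec_eq[of z] c by simp
        then show ?thesis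
          by (simp add: complexify_def vec_eq_iff algebra_simps flip: add_divide_distrib)
      qed
      moreover have "Re (d * cnj d) \<ge> 0" for d
        by simp
      ultimately show ?thesis
        by (rule tubeI)
    qed
  }
qed

theorem corollary4p7:
  fixes D :: "(real, 'n::finite) proj_space set"
  assumes "CARD('n) \<ge> 2"
    and "properly_convex D"
    and "open D"
  shows "complex_convex (elliptic_tube D)"
proof -
  have "proj_convex D"
    using assms(2) by (simp add: properly_convex_def)
  then obtain C where "open C" "convex C" "0 \<notin> C" "\<And>r x. r > 0 \<Longrightarrow> x \<in> C \<Longrightarrow> r *\<^sub>R x \<in> C"
    "\<And>v. v \<noteq> 0 \<Longrightarrow> proj_pt v \<in> D \<longleftrightarrow> v \<in> C \<or> - v \<in> C"
    by (rule convex_cone_of_proj_convex[OF _ assms(3)]) blast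
  then show ?thesis
    using elliptic_tube_eq_tube_domain[OF assms(1), of C D] complex_convex_tube_domain[of C] by simp
qed

end
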